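(* Let $G_0$ be the connected simply connected real Lie group with Lie algebra $\mathcal{G}_{6,6}$ (basis $x_1,\dots,x_6$, nonzero brackets $[x_1,x_2]=x_4$, $[x_2,x_3]=x_6$, $[x_2,x_4]=x_5$), with the global coordinates $(x^1,y^1,x^2,y^2,x^3,y^3)$ given by $$x=\exp(x^1x_1)\exp(y^1x_2)\exp(x^2x_3)\exp(y^2x_4)\exp(x^3x_5)\exp(y^3x_6).$$ Let $G$ be $G_0$ endowed with the left invariant structure of complex manifold defined by the complex structure $J$ on $\mathcal{G}_{6,6}$ with $Jx_1=x_2$, $Jx_3=x_4$, $Jx_5=-x_6$. Put $w^1=x^1+iy^1$, $w^2=x^2+iy^2$, $w^3=x^3-iy^3$ and $$\varphi^1=w^1,\qquad\varphi^2=w^2+\frac14\left(w^1\overline{w^1}-\frac{(\overline{w^1})^2}{2}\right),\qquad\varphi^3=w^3+\frac1{48}\left(-(\overline{w^1})^3+3\overline{w^1}(w^1)^2+24\overline{w^1}w^2\right).$$ Then $\varphi^1,\varphi^2,\varphi^3$ are holomorphic functions on $G$, and $F=(\varphi^1,\varphi^2,\varphi^3):G\to\mathbb{C}^3$ is a global holomorphic chart on $G$.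
   Context: Brackets of basis vectors not listed (and not obtained by antisymmetry) are zero. A complex structure on a real Lie algebra $\mathfrak{g}$ is a linear map $J$ with $J^2=-1$ and $[JX,JY]-[X,Y]-J[JX,Y]-J[X,JY]=0$ for all $X,Y\in\mathfrak{g}$. It extends uniquely to a left invariant almost complex structure on $G_0$, which is integrable by the Newlander–Nirenberg theorem; $G$ denotes $G_0$ with the resulting complex manifold structure. A smooth function $f:G_0\to\mathbb{C}$ is holomorphic on $G$ if and only if $(X+iJX)f=0$ for all left invariant vector fields $X$, where the left invariant vector field associated with $x_j$ is $(X_jf)(x)=\frac{d}{dt}f(x\exp(tx_j))|_{t=0}$. *)

theory Defs
  imports "HOL-Analysis.Analysis"
begin

section \<open>Smooth manifolds and Lie groups\<close>

text \<open>
  Only meant for open \<open>S\<close>, where the Frechet derivative is determined.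
\<close>

primrec Ck_on :: "nat \<Rightarrow> 'a::euclidean_space set \<Rightarrow> ('a \<Rightarrow> 'b::euclidean_space) \<Rightarrow> bool" where
  "Ck_on 0 S f \<longleftrightarrow> continuous_on S f"
| "Ck_on (Suc k) S f \<longleftrightarrow>
     (\<forall>x\<in>S. f differentiable (at x)) \<and> (\<forall>v. Ck_on k S (\<lambda>x. frechet_derivative f (at x) v))"

definition smooth_on :: "'a::euclidean_space set \<Rightarrow> ('a \<Rightarrow> 'b::euclidean_space) \<Rightarrow> bool" where
  "smooth_on S f \<longleftrightarrow> (\<forall>k. Ck_on k S f)"

type_synonym ('p, 'm) chart = "'p set \<times> ('p \<Rightarrow> 'm)"

definition topological_chart :: "('p::topological_space, 'm::euclidean_space) chart \<Rightarrow> bool" where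
  "topological_chart c \<longleftrightarrow>
     (case c of (U, \<phi>) \<Rightarrow>
        open U \<and> open (\<phi> ` U) \<and> inj_on \<phi> U \<and>
        continuous_on U \<phi> \<and> continuous_on (\<phi> ` U) (inv_into U \<phi>))"

text \<open>The atlas need not be maximal.\<close>

locale smooth_manifold =
  fixes atlas :: "('p::{t2_space, second_countable_topology}, 'm::euclidean_space) chart set"
  assumes charts: "c \<in> atlas \<Longrightarrow> topological_chart c"
    and covers: "(\<Union>c\<in>atlas. fst c) = UNIV"
    and compatible: "(U, \<phi>) \<in> atlas \<Longrightarrow> (V, \<psi>) \<in> atlas \<Longrightarrow>
           smooth_on (\<phi> ` (U \<inter> V)) (\<psi> \<circ> inv_into U \<phi>)"

definition std_atlas :: "('a::euclidean_space, 'a) chart set" where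
  "std_atlas = {(UNIV, \<lambda>x. x)}"

definition prod_atlas ::
  "('p, 'm) chart set \<Rightarrow> ('q, 'n) chart set \<Rightarrow> ('p \<times> 'q, 'm \<times> 'n) chart set" where
  "prod_atlas A B = {(U \<times> V, map_prod \<phi> \<psi>) | U \<phi> V \<psi>. (U, \<phi>) \<in> A \<and> (V, \<psi>) \<in> B}"

definition smooth_map_on ::
  "('p::topological_space, 'm::euclidean_space) chart set \<Rightarrow>
   ('q::topological_space, 'n::euclidean_space) chart set \<Rightarrow> 'p set \<Rightarrow> ('p \<Rightarrow> 'q) \<Rightarrow> bool" where
  "smooth_map_on A B W f \<longleftrightarrow>
     open W \<and> continuous_on W f \<and>
     (\<forall>(U, \<phi>)\<in>A. \<forall>(V, \<psi>)\<in>B.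
        smooth_on (\<phi> ` (U \<inter> W \<inter> f -` V)) (\<psi> \<circ> f \<circ> inv_into U \<phi>))"

text \<open>Membership in the maximal atlas, the values lying in an arbitrary Euclidean space.\<close>

definition smooth_chart ::
  "('p::topological_space, 'm::euclidean_space) chart set \<Rightarrow>
   'p set \<Rightarrow> ('p \<Rightarrow> 'a::euclidean_space) \<Rightarrow> bool" where
  "smooth_chart A U \<phi> \<longleftrightarrow>
     inj_on \<phi> U \<and> smooth_map_on A std_atlas U \<phi> \<and>
     smooth_map_on std_atlas A (\<phi> ` U) (inv_into U \<phi>)"

locale lie_group =
  smooth_manifold atlas + group mul one invert
  for atlas :: "('g::{t2_space, second_countable_topology}, 'm::euclidean_space) chart set"
    and mul :: "'g \<Rightarrow> 'g \<Rightarrow> 'g" and one :: 'g and invert :: "'g \<Rightarrow> 'g" +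
  assumes smooth_mult:
      "smooth_map_on (prod_atlas atlas atlas) atlas UNIV (\<lambda>(p, q). mul p q)"
    and smooth_invert: "smooth_map_on atlas atlas UNIV invert"

section \<open>The Lie algebra and the exponential map\<close>

abbreviation smooth_fun ::
  "('g::topological_space, 'm::euclidean_space) chart set \<Rightarrow> ('g \<Rightarrow> real) \<Rightarrow> bool" where
  "smooth_fun A f \<equiv> smooth_map_on A std_atlas UNIV f"

text \<open>
  Vector fields are derivations of the algebra of smooth functions; the value \<open>0\<close> outside of
  that algebra makes equality of operators coincide with equality of vector fields.
\<close>

definition left_invariant_fields ::
  "('g::topological_space, 'm::euclidean_space) chart set \<Rightarrow> ('g \<Rightarrow> 'g \<Rightarrow> 'g) \<Rightarrow>
   (('g \<Rightarrow> real) \<Rightarrow> 'g \<Rightarrow> real) set" where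
  "left_invariant_fields A mul = {D.
     (\<forall>f. \<not> smooth_fun A f \<longrightarrow> D f = (\<lambda>p. 0)) \<and>
     (\<forall>f. smooth_fun A f \<longrightarrow> smooth_fun A (D f)) \<and>
     (\<forall>f g a b. smooth_fun A f \<longrightarrow> smooth_fun A g \<longrightarrow>
        D (\<lambda>p. a * f p + b * g p) = (\<lambda>p. a * D f p + b * D g p)) \<and>
     (\<forall>f g. smooth_fun A f \<longrightarrow> smooth_fun A g \<longrightarrow>
        D (\<lambda>p. f p * g p) = (\<lambda>p. D f p * g p + f p * D g p)) \<and>
     (\<forall>f q. smooth_fun A f \<longrightarrow> D (\<lambda>p. f (mul q p)) = (\<lambda>p. D f (mul q p)))}"

text \<open>
  \<open>\<iota>\<close> identifies the Lie algebra with bracket \<open>br\<close> with the Lie algebra of left invariant vector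
  fields of the group, that is, it is an isomorphism of real Lie algebras.
\<close>

definition lie_algebra_iso ::
  "('g::topological_space, 'm::euclidean_space) chart set \<Rightarrow> ('g \<Rightarrow> 'g \<Rightarrow> 'g) \<Rightarrow>
   ('v::real_vector \<Rightarrow> 'v \<Rightarrow> 'v) \<Rightarrow> ('v \<Rightarrow> ('g \<Rightarrow> real) \<Rightarrow> 'g \<Rightarrow> real) \<Rightarrow> bool" where
  "lie_algebra_iso A mul br \<iota> \<longleftrightarrow>
     bij_betw \<iota> UNIV (left_invariant_fields A mul) \<and>
     (\<forall>a b X Y f p. \<iota> (a *\<^sub>R X + b *\<^sub>R Y) f p = a * \<iota> X f p + b * \<iota> Y f p) \<and>
     (\<forall>X Y f p. smooth_fun A f \<longrightarrow> \<iota> (br X Y) f p = \<iota> X (\<iota> Y f) p - \<iota> Y (\<iota> X f) p)"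

text \<open>
  The exponential map, characterised by the fact that \<open>t \<mapsto> e (t X)\<close> is the one-parameter subgroup
  generated by the left invariant vector field \<open>\<iota> X\<close>.
\<close>

definition exponential_map ::
  "('g::topological_space, 'm::euclidean_space) chart set \<Rightarrow> ('g \<Rightarrow> 'g \<Rightarrow> 'g) \<Rightarrow>
   ('v::real_vector \<Rightarrow> ('g \<Rightarrow> real) \<Rightarrow> 'g \<Rightarrow> real) \<Rightarrow> ('v \<Rightarrow> 'g) \<Rightarrow> bool" where
  "exponential_map A mul \<iota> e \<longleftrightarrow>
     (\<forall>X. smooth_map_on std_atlas A UNIV (\<lambda>t::real. e (t *\<^sub>R X)) \<and>
          (\<forall>s t. e ((s + t) *\<^sub>R X) = mul (e (s *\<^sub>R X)) (e (t *\<^sub>R X))) \<and>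
          (\<forall>f p. smooth_fun A f \<longrightarrow>
             ((\<lambda>t. f (mul p (e (t *\<^sub>R X)))) has_real_derivative \<iota> X f p) (at 0)))"

section \<open>Left invariant complex structures\<close>

definition lie_complex_structure ::
  "('v::real_vector \<Rightarrow> 'v \<Rightarrow> 'v) \<Rightarrow> ('v \<Rightarrow> 'v) \<Rightarrow> bool" where
  "lie_complex_structure br J \<longleftrightarrow>
     linear J \<and> (\<forall>X. J (J X) = - X) \<and>
     (\<forall>X Y. br (J X) (J Y) - br X Y - J (br (J X) Y) - J (br X (J Y)) = 0)"

definition left_derivative ::
  "('g \<Rightarrow> 'g \<Rightarrow> 'g) \<Rightarrow> ('v::real_vector \<Rightarrow> 'g) \<Rightarrow> 'v \<Rightarrow> ('g \<Rightarrow> complex) \<Rightarrow> 'g \<Rightarrow> complex" where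
  "left_derivative mul e X f p =
     vector_derivative (\<lambda>t. f (mul p (e (t *\<^sub>R X)))) (at 0)"

definition J_holomorphic_on ::
  "('g::topological_space, 'm::euclidean_space) chart set \<Rightarrow> ('g \<Rightarrow> 'g \<Rightarrow> 'g) \<Rightarrow>
   ('v::real_vector \<Rightarrow> 'g) \<Rightarrow> ('v \<Rightarrow> 'v) \<Rightarrow> 'g set \<Rightarrow> ('g \<Rightarrow> complex) \<Rightarrow> bool" where
  "J_holomorphic_on A mul e J U f \<longleftrightarrow>
     smooth_map_on A std_atlas U f \<and>
     (\<forall>X. \<forall>p\<in>U. left_derivative mul e X f p + \<i> * left_derivative mul e (J X) f p = 0)"

text \<open>
  The holomorphic charts of the complex manifold determined by \<open>J\<close>: diffeomorphisms of open sets
  onto open sets of complex n-space whose components are holomorphic.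
\<close>

definition holomorphic_charts ::
  "('g::topological_space, 'm::euclidean_space) chart set \<Rightarrow> ('g \<Rightarrow> 'g \<Rightarrow> 'g) \<Rightarrow>
   ('v::real_vector \<Rightarrow> 'g) \<Rightarrow> ('v \<Rightarrow> 'v) \<Rightarrow> ('g, complex ^ 'n) chart set" where
  "holomorphic_charts A mul e J =
     {(U, F). smooth_chart A U F \<and> (\<forall>k. J_holomorphic_on A mul e J U (\<lambda>p. F p $ k))}"

section \<open>The Lie algebra with nonzero brackets [x1,x2] = x4, [x2,x3] = x6, [x2,x4] = x5\<close>

definition bas :: "6 \<Rightarrow> real ^ 6" where
  "bas k = axis k 1"

definition g66_bracket :: "real ^ 6 \<Rightarrow> real ^ 6 \<Rightarrow> real ^ 6" where
  "g66_bracket u v =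
     (u $ 1 * v $ 2 - u $ 2 * v $ 1) *\<^sub>R bas 4 +
     (u $ 2 * v $ 3 - u $ 3 * v $ 2) *\<^sub>R bas 6 +
     (u $ 2 * v $ 4 - u $ 4 * v $ 2) *\<^sub>R bas 5"

definition g66_J :: "real ^ 6 \<Rightarrow> real ^ 6" where
  "g66_J u =
     u $ 1 *\<^sub>R bas 2 - u $ 2 *\<^sub>R bas 1 + u $ 3 *\<^sub>R bas 4 - u $ 4 *\<^sub>R bas 3
     - u $ 5 *\<^sub>R bas 6 + u $ 6 *\<^sub>R bas 5"

lemma UNIV_6: "(UNIV :: 6 set) = {1, 2, 3, 4, 5, 6}"
proof -
  have "{1, 2, 3, 4, 5, 6} \<subseteq> (UNIV :: 6 set)" by simp
  moreover have "card {1, 2, 3, 4, 5, 6 :: 6} = card (UNIV :: 6 set)" by simp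
  ultimately show ?thesis by (metis card_subset_eq finite)
qed

lemma forall_6: "(\<forall>k::6. P k) \<longleftrightarrow> P 1 \<and> P 2 \<and> P 3 \<and> P 4 \<and> P 5 \<and> P 6"
  using UNIV_6 by (metis (full_types) UNIV_I empty_iff insert_iff)

lemma bas_nth: "bas k $ l = (if k = l then 1 else 0)"
  by (auto simp: bas_def axis_def)

lemma g66_J_bas:
  "g66_J (bas 1) = bas 2" "g66_J (bas 3) = bas 4" "g66_J (bas 5) = - bas 6"
  by (simp_all add: g66_J_def bas_nth)

lemma g66_bracket_bas:
  "g66_bracket (bas 1) (bas 2) = bas 4"
  "g66_bracket (bas 2) (bas 3) = bas 6"
  "g66_bracket (bas 2) (bas 4) = bas 5"
  by (simp_all add: g66_bracket_def bas_nth)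

lemma g66_bracket_bas_zero:
  assumes "(k, l) \<notin> {(1, 2), (2, 1), (2, 3), (3, 2), (2, 4), (4, 2)}"
  shows "g66_bracket (bas k) (bas l) = 0"
  using assms by (auto simp: g66_bracket_def bas_nth)

lemma g66_bracket_antisym: "g66_bracket u v = - g66_bracket v u"
  by (simp add: g66_bracket_def vec_eq_iff forall_6 bas_nth)

lemma g66_bracket_jacobi:
  "g66_bracket u (g66_bracket v w) + g66_bracket v (g66_bracket w u)
     + g66_bracket w (g66_bracket u v) = 0"
  by (simp add: g66_bracket_def vec_eq_iff forall_6 bas_nth algebra_simps)

lemma bilinear_g66_bracket: "bilinear g66_bracket"
  by (auto intro!: linearI simp: bilinear_def g66_bracket_def vec_eq_iff forall_6 bas_nth algebra_simps)

lemma g66_J_complex_structure: "lie_complex_structure g66_bracket g66_J"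
  unfolding lie_complex_structure_def
proof (intro conjI allI)
  show "linear g66_J"
    by (rule linearI) (simp_all add: g66_J_def vec_eq_iff forall_6 bas_nth algebra_simps)
  show "g66_J (g66_J X) = - X" for X
    by (simp add: g66_J_def vec_eq_iff forall_6 bas_nth)
  show "g66_bracket (g66_J X) (g66_J Y) - g66_bracket X Y
          - g66_J (g66_bracket (g66_J X) Y) - g66_J (g66_bracket X (g66_J Y)) = 0" for X Y
    by (simp add: g66_J_def g66_bracket_def vec_eq_iff forall_6 bas_nth algebra_simps)
qed

section \<open>The functions of the theorem\<close>

text \<open>
  In these definitions \<open>c\<close> is the coordinate map, whose components \<open>c p $ 1, \<dots>, c p $ 6\<close> are the
  coordinates \<open>x\<^sup>1, y\<^sup>1, x\<^sup>2, y\<^sup>2, x\<^sup>3, y\<^sup>3\<close> of \<open>p\<close>, in this order.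
\<close>

definition w1 :: "('g \<Rightarrow> real ^ 6) \<Rightarrow> 'g \<Rightarrow> complex" where
  "w1 c p = complex_of_real (c p $ 1) + \<i> * complex_of_real (c p $ 2)"

definition w2 :: "('g \<Rightarrow> real ^ 6) \<Rightarrow> 'g \<Rightarrow> complex" where
  "w2 c p = complex_of_real (c p $ 3) + \<i> * complex_of_real (c p $ 4)"

definition w3 :: "('g \<Rightarrow> real ^ 6) \<Rightarrow> 'g \<Rightarrow> complex" where
  "w3 c p = complex_of_real (c p $ 5) - \<i> * complex_of_real (c p $ 6)"

definition phi1 :: "('g \<Rightarrow> real ^ 6) \<Rightarrow> 'g \<Rightarrow> complex" where
  "phi1 c p = w1 c p"

definition phi2 :: "('g \<Rightarrow> real ^ 6) \<Rightarrow> 'g \<Rightarrow> complex" where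
  "phi2 c p = w2 c p + 1 / 4 * (w1 c p * cnj (w1 c p) - (cnj (w1 c p)) ^ 2 / 2)"

definition phi3 :: "('g \<Rightarrow> real ^ 6) \<Rightarrow> 'g \<Rightarrow> complex" where
  "phi3 c p = w3 c p + 1 / 48 *
     (- ((cnj (w1 c p)) ^ 3) + 3 * cnj (w1 c p) * (w1 c p) ^ 2 + 24 * cnj (w1 c p) * w2 c p)"

end

(*
  Write D_j for the left invariant field of x_j and v_1, ..., v_6 for the exponential coordinates.
  Where v_{j+1} = ... = v_6 = 0, the product formula shows D_j = d/dv_j. The commutation relations
  propagate this to all points: once D_i = d/dv_i is known everywhere, the coefficient D_j v_k has
  the derivative [D_i, D_j] v_k along v_i. Working down from j = 6 this gives D_j = d/dv_j for
  j = 3, ..., 6, then D_2 = d/dv_2 - v_4 d/dv_5 - v_3 d/dv_6, and, by integrating along the flow of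
  D_2, D_1 = d/dv_1 - v_2 d/dv_4 + (v_2^2/2) d/dv_5. The equations (X + i JX) phi = 0 are then
  polynomial identities, and phi is a triangular polynomial automorphism in w1, w2, w3.
*)
theory Submission
  imports Defs
begin

section \<open>Calculus of smooth maps\<close>

text \<open>Agreement on an open set is agreement near each of its points, so the Frechet
  derivatives agree there too and the induction passes to them.\<close>

lemma Ck_on_cong:
  assumes "open S" "\<And>x. x \<in> S \<Longrightarrow> f x = g x" "Ck_on k S f"
  shows "Ck_on k S g"
  using assms
proof (induction k arbitrary: f g)
  case 0
  then show ?case by (simp cong: continuous_on_cong)
next
  case (Suc k)
  have D: "(g has_derivative frechet_derivative f (at x)) (at x)" if "x \<in> S" for x
  proof (rule has_derivative_transform_within_open[OF _ \<open>open S\<close> that])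
    show "(f has_derivative frechet_derivative f (at x)) (at x)"
      using Suc.prems(3) that by (simp flip: frechet_derivative_works)
  qed (use Suc.prems(2) in auto)
  have "Ck_on k S (\<lambda>x. frechet_derivative g (at x) v)" for v
  proof (rule Suc.IH[OF \<open>open S\<close>])
    show "Ck_on k S (\<lambda>x. frechet_derivative f (at x) v)"
      using Suc.prems(3) by simp
  qed (use frechet_derivative_at[OF D] in metis)
  then show ?case
    using D by (auto simp: differentiable_def)
qed

text \<open>Lets an explicit derivative \<open>f'\<close> stand in for
  \<open>frechet_derivative\<close>, so that differentiation rules become closure properties by
  induction on \<open>k\<close>.\<close>

lemma Ck_on_SucI:
  assumes "open S" "\<And>x. x \<in> S \<Longrightarrow> (f has_derivative f' x) (at x)"
    and "\<And>v. Ck_on k S (\<lambda>x. f' x v)"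
  shows "Ck_on (Suc k) S f"
proof -
  have "Ck_on k S (\<lambda>x. frechet_derivative f (at x) v)" for v
    by (rule Ck_on_cong[OF assms(1) _ assms(3)[of v]])
      (use frechet_derivative_at[OF assms(2)] in metis)
  then show ?thesis
    using assms(2) by (auto simp: differentiable_def)
qed

lemma Ck_on_has_derivative:
  "Ck_on (Suc k) S f \<Longrightarrow> x \<in> S \<Longrightarrow> (f has_derivative frechet_derivative f (at x)) (at x)"
  by (simp flip: frechet_derivative_works)

lemma Ck_on_lower: "Ck_on (Suc k) S f \<Longrightarrow> Ck_on k S f"
proof (induction k arbitrary: f)
  case 0
  then show ?case
    by (auto intro!: continuous_at_imp_continuous_on differentiable_imp_continuous_within)
next
  case (Suc k)
  then show ?case
    using Ck_on.simps(2) by blast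
qed

lemma Ck_on_subset: "Ck_on k S f \<Longrightarrow> T \<subseteq> S \<Longrightarrow> Ck_on k T f"
  by (induction k arbitrary: f) (auto intro: continuous_on_subset)

lemma Ck_on_const: "Ck_on k S (\<lambda>x. c)"
  by (induction k arbitrary: c) (simp_all add: frechet_derivative_const)

lemma Ck_on_add:
  assumes "open S" "Ck_on k S f" "Ck_on k S g"
  shows "Ck_on k S (\<lambda>x. f x + g x)"
  using assms
proof (induction k arbitrary: f g)
  case 0
  then show ?case by (simp add: continuous_on_add)
next
  case (Suc k)
  show ?case
    by (rule Ck_on_SucI[OF \<open>open S\<close> has_derivative_add[OF
          Ck_on_has_derivative[OF Suc.prems(2)] Ck_on_has_derivative[OF Suc.prems(3)]]])
      (use Suc in auto)
qed

lemma Ck_on_sum: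
  assumes "open S" "\<And>i. i \<in> I \<Longrightarrow> Ck_on k S (f i)"
  shows "Ck_on k S (\<lambda>x. \<Sum>i\<in>I. f i x)"
  using assms(2)
  by (induction I rule: infinite_finite_induct) (auto intro: Ck_on_const Ck_on_add assms(1))

lemma Ck_on_bounded_linear:
  assumes "bounded_linear L" "open S" "Ck_on k S f"
  shows "Ck_on k S (\<lambda>x. L (f x))"
  using assms(3)
proof (induction k arbitrary: f)
  case 0
  then show ?case using assms(1) by (simp add: bounded_linear.continuous_on)
next
  case (Suc k)
  show ?case
    by (rule Ck_on_SucI[OF \<open>open S\<close>
          bounded_linear.has_derivative[OF assms(1) Ck_on_has_derivative[OF Suc.prems]]])
      (use Suc in auto)
qed

lemma Ck_on_bounded_bilinear:
  assumes "bounded_bilinear h" "open S" "Ck_on k S f" "Ck_on k S g"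
  shows "Ck_on k S (\<lambda>x. h (f x) (g x))"
  using assms(3,4)
proof (induction k arbitrary: f g)
  case 0
  then show ?case using assms(1) by (simp add: bounded_bilinear.continuous_on)
next
  case (Suc k)
  show ?case
  proof (rule Ck_on_SucI[OF \<open>open S\<close> bounded_bilinear.FDERIV[OF assms(1)
          Ck_on_has_derivative[OF Suc.prems(1)] Ck_on_has_derivative[OF Suc.prems(2)]]])
    show "Ck_on k S (\<lambda>x. h (f x) (frechet_derivative g (at x) v)
        + h (frechet_derivative f (at x) v) (g x))" for v
      \<comment> \<open>The product rule keeps one factor undifferentiated; it fits the induction
        hypothesis after lowering from \<open>Suc k\<close> to \<open>k\<close>.\<close>
      using Suc.prems(1)[THEN Ck_on_lower] Suc.prems(2)[THEN Ck_on_lower] Suc.prems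
      by (intro Ck_on_add Suc.IH assms(2)) auto
  qed
qed

lemma Ck_on_id: "open S \<Longrightarrow> Ck_on k S (\<lambda>x. x)"
  by (cases k) (auto intro!: Ck_on_SucI[where f' = "\<lambda>x v. v"] continuous_on_id Ck_on_const
      simp del: Ck_on.simps(2))

lemma Ck_on_compose:
  fixes f :: "'a::euclidean_space \<Rightarrow> 'b::euclidean_space"
    and g :: "'b \<Rightarrow> 'c::euclidean_space"
  assumes "open S" "Ck_on k S f" "Ck_on k T g" "f ` S \<subseteq> T"
  shows "Ck_on k S (\<lambda>x. g (f x))"
  using assms(2,3)
proof (induction k arbitrary: g)
  case 0
  then show ?case using assms(4) by (auto intro: continuous_on_compose2)
next
  case (Suc k)
  let ?f' = "\<lambda>x. frechet_derivative f (at x)" and ?g' = "\<lambda>y. frechet_derivative g (at y)"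
  \<comment> \<open>The chain rule evaluates \<open>?g' (f x)\<close> in the moving direction
    \<open>?f' x v\<close>. Expanding that direction in the basis leaves fixed directions
    \<open>b\<close> with scalar coefficients, to which the induction hypothesis applies.\<close>
  let ?h = "\<lambda>x v. \<Sum>b\<in>Basis. (?f' x v \<bullet> b) *\<^sub>R ?g' (f x) b"
  show ?case
  proof (rule Ck_on_SucI[OF \<open>open S\<close>])
    fix x assume x: "x \<in> S"
    then have g: "(g has_derivative ?g' (f x)) (at (f x))"
      using Ck_on_has_derivative[OF Suc.prems(2)] assms(4) by auto
    have "(\<lambda>v. ?g' (f x) (?f' x v)) = ?h x"
    proof
      fix v
      have "?g' (f x) (\<Sum>b\<in>Basis. (?f' x v \<bullet> b) *\<^sub>R b) = ?h x v"
        by (simp add: linear_sum[OF has_derivative_linear[OF g]]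
            linear_scale[OF has_derivative_linear[OF g]])
      then show "?g' (f x) (?f' x v) = ?h x v"
        by (simp add: euclidean_representation)
    qed
    then show "((\<lambda>x. g (f x)) has_derivative ?h x) (at x)"
      using has_derivative_compose[OF Ck_on_has_derivative[OF Suc.prems(1) x] g] by simp
  next
    fix v
    show "Ck_on k S (\<lambda>x. ?h x v)"
    proof (intro Ck_on_sum Ck_on_bounded_bilinear[OF bounded_bilinear_scaleR] \<open>open S\<close>)
      fix b :: 'b
      show "Ck_on k S (\<lambda>x. ?f' x v \<bullet> b)"
        using Suc.prems(1)
        by (intro Ck_on_bounded_linear[OF bounded_linear_inner_left] \<open>open S\<close>) simp
      show "Ck_on k S (\<lambda>x. ?g' (f x) b)"
        using Suc.prems by (intro Suc.IH Ck_on_lower[of k S]) auto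
    qed
  qed
qed

section \<open>Closure properties of smooth maps on open sets\<close>

lemma smooth_on_const: "smooth_on S (\<lambda>x. c)"
  by (simp add: smooth_on_def Ck_on_const)

lemma smooth_on_id: "open S \<Longrightarrow> smooth_on S (\<lambda>x. x)"
  by (simp add: smooth_on_def Ck_on_id)

lemma smooth_on_add:
  "open S \<Longrightarrow> smooth_on S f \<Longrightarrow> smooth_on S g \<Longrightarrow> smooth_on S (\<lambda>x. f x + g x)"
  by (simp add: smooth_on_def Ck_on_add)

lemma smooth_on_sum:
  "open S \<Longrightarrow> (\<And>i. i \<in> I \<Longrightarrow> smooth_on S (f i)) \<Longrightarrow> smooth_on S (\<lambda>x. \<Sum>i\<in>I. f i x)"
  by (simp add: smooth_on_def Ck_on_sum)

lemma smooth_on_bounded_linear: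
  "bounded_linear L \<Longrightarrow> open S \<Longrightarrow> smooth_on S f \<Longrightarrow> smooth_on S (\<lambda>x. L (f x))"
  by (simp add: smooth_on_def Ck_on_bounded_linear)

lemma smooth_on_minus: "open S \<Longrightarrow> smooth_on S f \<Longrightarrow> smooth_on S (\<lambda>x. - f x)"
  by (rule smooth_on_bounded_linear[OF bounded_linear_minus[OF bounded_linear_ident]])

lemma smooth_on_diff:
  "open S \<Longrightarrow> smooth_on S f \<Longrightarrow> smooth_on S g \<Longrightarrow> smooth_on S (\<lambda>x. f x - g x)"
  using smooth_on_add[OF _ _ smooth_on_minus, of S f g] by simp

lemma smooth_on_mult:
  fixes f g :: "'a::euclidean_space \<Rightarrow> 'b::{euclidean_space, real_normed_algebra}"
  shows "open S \<Longrightarrow> smooth_on S f \<Longrightarrow> smooth_on S g \<Longrightarrow> smooth_on S (\<lambda>x. f x * g x)"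
  by (simp add: smooth_on_def Ck_on_bounded_bilinear[OF bounded_bilinear_mult])

lemma smooth_on_power:
  fixes f :: "'a::euclidean_space \<Rightarrow> 'b::{euclidean_space, real_normed_algebra_1}"
  shows "open S \<Longrightarrow> smooth_on S f \<Longrightarrow> smooth_on S (\<lambda>x. f x ^ n)"
  by (induction n) (auto intro: smooth_on_const smooth_on_mult)

lemma smooth_on_vec:
  fixes f :: "'a::euclidean_space \<Rightarrow> 'b::euclidean_space ^ 'n"
  assumes "open S" "\<And>k. smooth_on S (\<lambda>x. f x $ k)"
  shows "smooth_on S f"
proof -
  have lin: "bounded_linear (axis k :: 'b \<Rightarrow> 'b ^ 'n)" for k
    by (auto intro!: linear_conv_bounded_linear[THEN iffD1] linearI
        simp: axis_def vec_eq_iff)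
  have "f = (\<lambda>x. \<Sum>k\<in>UNIV. axis k (f x $ k))"
    by (auto simp: fun_eq_iff vec_eq_iff axis_def if_distrib cong: if_cong)
  then show ?thesis
    using smooth_on_sum[OF assms(1), of UNIV "\<lambda>k x. axis k (f x $ k)"]
      smooth_on_bounded_linear[OF lin assms(1) assms(2)] by auto
qed

lemma smooth_on_compose:
  assumes "open S" "smooth_on S f" "smooth_on T g" "f ` S \<subseteq> T"
  shows "smooth_on S (\<lambda>x. g (f x))"
  using assms Ck_on_compose unfolding smooth_on_def by blast

lemmas smooth_on_intros =
  smooth_on_const smooth_on_id smooth_on_add smooth_on_diff smooth_on_minus smooth_on_mult
  smooth_on_power smooth_on_bounded_linear[OF bounded_linear_cnj]
  smooth_on_bounded_linear[OF bounded_linear_of_real]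
  smooth_on_bounded_linear[OF bounded_linear_Re] smooth_on_bounded_linear[OF bounded_linear_Im]
  smooth_on_bounded_linear[OF bounded_linear_vec_nth]

section \<open>Smooth maps on a manifold and change of a global chart\<close>

lemma open_chart_image:
  assumes "topological_chart (U, \<phi>)" "open W"
  shows "open (\<phi> ` (U \<inter> W))"
proof -
  have *: "open (\<phi> ` U)" "inj_on \<phi> U" "continuous_on (\<phi> ` U) (inv_into U \<phi>)"
    using assms(1) by (auto simp: topological_chart_def)
  have "\<phi> ` (U \<inter> W) = inv_into U \<phi> -` W \<inter> \<phi> ` U"
    using *(2) by (auto simp: inv_into_f_f)
  then show ?thesis
    using continuous_open_vimage[of W] continuous_on_open_vimage[OF *(1)] *(3) assms(2) by metis
qed

context smooth_manifold
begin

lemma smooth_map_on_compose: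
  assumes "smooth_map_on atlas std_atlas UNIV f" "smooth_on UNIV g"
  shows "smooth_map_on atlas std_atlas UNIV (\<lambda>p. g (f p))"
proof -
  have "continuous_on UNIV g"
    using assms(2) Ck_on.simps(1) unfolding smooth_on_def by blast
  moreover have f: "continuous_on UNIV f"
    using assms(1) by (auto simp: smooth_map_on_def)
  ultimately have "continuous_on UNIV (\<lambda>p. g (f p))"
    by (rule continuous_on_compose2) auto
  moreover have "smooth_on (\<phi> ` U) (\<lambda>x. g (f (inv_into U \<phi> x)))" if "(U, \<phi>) \<in> atlas" for U \<phi>
  proof (rule smooth_on_compose[OF _ _ assms(2)])
    show "open (\<phi> ` U)"
      using open_chart_image[OF charts[OF that] open_UNIV] by simp
    show "smooth_on (\<phi> ` U) (\<lambda>x. f (inv_into U \<phi> x))"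
      using assms(1) that by (force simp: smooth_map_on_def std_atlas_def o_def)
  qed auto
  ultimately show ?thesis
    by (auto simp: smooth_map_on_def std_atlas_def o_def)
qed

text \<open>The inverse of the composite is \<open>inv c\<close> after \<open>Q\<close>, so both
  directions are compositions of smooth maps. With \<open>c\<close> the exponential coordinates and
  \<open>P\<close> the map \<open>phi_map\<close>, this yields the chart of the theorem.\<close>

lemma smooth_chart_compose:
  fixes P :: "'a::euclidean_space \<Rightarrow> 'b::euclidean_space"
  assumes c: "smooth_chart atlas UNIV c" "range c = UNIV"
    and P: "smooth_on UNIV P" "smooth_on UNIV Q" "\<And>v. Q (P v) = v" "\<And>w. P (Q w) = w"
  shows "smooth_chart atlas UNIV (\<lambda>p. P (c p))"
proof -
  have inj: "inj c" and inv: "smooth_map_on std_atlas atlas UNIV (inv c)"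
    using c by (auto simp: smooth_chart_def)
  have inj': "inj (\<lambda>p. P (c p))"
    using inj by (auto intro!: inj_on_inverseI[where g = "\<lambda>w. inv c (Q w)"] simp: P(3))
  have surj': "range (\<lambda>p. P (c p)) = UNIV"
    by (rule surjI[where f = "\<lambda>w. inv c (Q w)"]) (simp add: P(4) surj_f_inv_f[OF c(2)])
  have inv': "inv (\<lambda>p. P (c p)) w = inv c (Q w)" for w
    by (rule inv_f_eq[OF inj']) (simp add: P(4) surj_f_inv_f[OF c(2)])
  have cinv: "continuous_on UNIV (inv c)"
    using inv by (auto simp: smooth_map_on_def)
  have cQ: "continuous_on UNIV Q"
    using P(2) Ck_on.simps(1) unfolding smooth_on_def by blast
  have cont: "continuous_on UNIV (\<lambda>w. inv c (Q w))"
    by (rule continuous_on_compose2[OF cinv cQ]) auto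
  \<comment> \<open>\<open>Q\<close> maps the preimage of \<open>V\<close> under the composite into
    its preimage under \<open>inv c\<close>, where the chart expression of \<open>inv c\<close> is
    smooth.\<close>
  have "smooth_on ((\<lambda>w. inv c (Q w)) -` V) (\<lambda>w. \<psi> (inv c (Q w)))" if "(V, \<psi>) \<in> atlas" for V \<psi>
  proof (rule smooth_on_compose[where f = Q])
    have "open V"
      using charts[OF that] by (simp add: topological_chart_def)
    then show "open ((\<lambda>w. inv c (Q w)) -` V)"
      using cont by (simp add: continuous_on_open_vimage)
    show "smooth_on ((\<lambda>w. inv c (Q w)) -` V) Q"
      using P(2) Ck_on_subset unfolding smooth_on_def by blast
    show "smooth_on (inv c -` V) (\<lambda>v. \<psi> (inv c v))"
      using inv that by (force simp: smooth_map_on_def std_atlas_def o_def inv_id)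
  qed auto
  then have "smooth_map_on std_atlas atlas UNIV (inv (\<lambda>p. P (c p)))"
    using cont by (auto simp: smooth_map_on_def std_atlas_def o_def inv_id ext[OF inv'])
  then show ?thesis
    using inj' surj' c(1) smooth_map_on_compose[OF _ P(1)] by (auto simp: smooth_chart_def)
qed

end

section \<open>The polynomial change of coordinates\<close>

lemma smooth_on_phi:
  "smooth_on UNIV (phi1 (\<lambda>v. v))"
  "smooth_on UNIV (phi2 (\<lambda>v. v))"
  "smooth_on UNIV (phi3 (\<lambda>v. v))"
  unfolding phi1_def phi2_def phi3_def w1_def w2_def w3_def divide_inverse
  by (intro smooth_on_intros open_UNIV)+

text \<open>With the identity as coordinate map the functions become polynomials on
  \<open>real ^ 6\<close>, which can be studied apart from the group.\<close>

lemma phi_id: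
  "phi1 (\<lambda>v. v) (c p) = phi1 c p"
  "phi2 (\<lambda>v. v) (c p) = phi2 c p"
  "phi3 (\<lambda>v. v) (c p) = phi3 c p"
  by (simp_all add: phi1_def phi2_def phi3_def w1_def w2_def w3_def)

definition phi_map :: "real ^ 6 \<Rightarrow> complex ^ 3" where
  "phi_map v = vector [phi1 (\<lambda>v. v) v, phi2 (\<lambda>v. v) v, phi3 (\<lambda>v. v) v]"

text \<open>The relations defining \<open>\<phi>\<^sup>1\<close>, \<open>\<phi>\<^sup>2\<close>, \<open>\<phi>\<^sup>3\<close> are triangular in \<open>w\<^sup>1\<close>, \<open>w\<^sup>2\<close>, \<open>w\<^sup>3\<close>.\<close>

definition w2_of_phi :: "complex ^ 3 \<Rightarrow> complex" where
  "w2_of_phi z = z $ 2 - 1 / 4 * (z $ 1 * cnj (z $ 1) - (cnj (z $ 1)) ^ 2 / 2)"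

definition w3_of_phi :: "complex ^ 3 \<Rightarrow> complex" where
  "w3_of_phi z = z $ 3 - 1 / 48 *
     (- ((cnj (z $ 1)) ^ 3) + 3 * cnj (z $ 1) * (z $ 1) ^ 2 + 24 * cnj (z $ 1) * w2_of_phi z)"

text \<open>The minus sign in the last component reflects that \<open>w3\<close> has imaginary part
  minus the sixth coordinate.\<close>

definition phi_inv :: "complex ^ 3 \<Rightarrow> real ^ 6" where
  "phi_inv z = (\<chi> k. if k = 1 then Re (z $ 1) else if k = 2 then Im (z $ 1)
     else if k = 3 then Re (w2_of_phi z) else if k = 4 then Im (w2_of_phi z)
     else if k = 5 then Re (w3_of_phi z) else - Im (w3_of_phi z))"

lemma w_phi_inv:
  "w1 (\<lambda>v. v) (phi_inv z) = z $ 1"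
  "w2 (\<lambda>v. v) (phi_inv z) = w2_of_phi z"
  "w3 (\<lambda>v. v) (phi_inv z) = w3_of_phi z"
  by (simp_all add: phi_inv_def w1_def w2_def w3_def complex_eq_iff)

lemma phi_map_phi_inv: "phi_map (phi_inv z) = z"
  by (simp add: phi_map_def phi1_def phi2_def phi3_def w_phi_inv vec_eq_iff forall_3
      w3_of_phi_def w2_of_phi_def)

lemma w_of_phi_map:
  "phi_map v $ 1 = w1 (\<lambda>v. v) v"
  "w2_of_phi (phi_map v) = w2 (\<lambda>v. v) v"
  "w3_of_phi (phi_map v) = w3 (\<lambda>v. v) v"
  by (simp_all add: phi_map_def w3_of_phi_def w2_of_phi_def phi1_def phi2_def phi3_def)

lemma phi_inv_phi_map: "phi_inv (phi_map v) = v"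
  by (simp add: phi_inv_def w_of_phi_map vec_eq_iff forall_6)
    (simp add: w1_def w2_def w3_def)

lemma smooth_on_phi_map: "smooth_on UNIV phi_map"
proof (rule smooth_on_vec)
  show "smooth_on UNIV (\<lambda>v. phi_map v $ k)" for k
    using smooth_on_phi exhaust_3[of k] by (auto simp: phi_map_def)
qed simp

lemma smooth_on_phi_inv: "smooth_on UNIV phi_inv"
proof (rule smooth_on_vec)
  have "smooth_on UNIV w2_of_phi"
    unfolding w2_of_phi_def divide_inverse
    by (intro smooth_on_intros open_UNIV)
  moreover from this have "smooth_on UNIV w3_of_phi"
    unfolding w3_of_phi_def divide_inverse
    by (intro smooth_on_intros open_UNIV)
  ultimately have "\<forall>k. smooth_on UNIV (\<lambda>z. phi_inv z $ k)"
    unfolding forall_6 by (simp add: phi_inv_def smooth_on_intros)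
  then show "smooth_on UNIV (\<lambda>z. phi_inv z $ k)" for k ..
qed simp

section \<open>The left invariant frame in exponential coordinates\<close>

locale g66_group = lie_group atlas mul one invert
  for atlas :: "('g::{t2_space, second_countable_topology}, real ^ 6) chart set"
    and mul one invert +
  fixes \<iota> :: "real ^ 6 \<Rightarrow> ('g \<Rightarrow> real) \<Rightarrow> 'g \<Rightarrow> real"
    and e :: "real ^ 6 \<Rightarrow> 'g"
    and coords :: "'g \<Rightarrow> real ^ 6"
  assumes iso: "lie_algebra_iso atlas mul g66_bracket \<iota>"
    and exp: "exponential_map atlas mul \<iota> e"
    and chart: "smooth_chart atlas UNIV coords"
    and coords_iff: "\<And>p v. coords p = v \<longleftrightarrow>
           p = mul (mul (mul (mul (mul
                 (e (v $ 1 *\<^sub>R bas 1)) (e (v $ 2 *\<^sub>R bas 2))) (e (v $ 3 *\<^sub>R bas 3)))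
                 (e (v $ 4 *\<^sub>R bas 4))) (e (v $ 5 *\<^sub>R bas 5))) (e (v $ 6 *\<^sub>R bas 6))"
begin

section \<open>The exponential map and differentiation along flows\<close>

lemma exp_add: "e ((s + t) *\<^sub>R X) = mul (e (s *\<^sub>R X)) (e (t *\<^sub>R X))"
  using exp by (simp add: exponential_map_def)

lemma exp_zero: "e 0 = one"
proof -
  have "mul (e 0) (e 0) = mul one (e 0)"
    using exp_add[of 0 0 0] by (simp add: group_left_neutral)
  then show ?thesis
    by (simp only: right_cancel)
qed

lemma exp_minus: "mul (e (- X)) (e X) = one"
  using exp_add[of "-1" 1 X] by (simp add: exp_zero)

lemma smooth_field: "smooth_fun atlas f \<Longrightarrow> smooth_fun atlas (\<iota> X f)"
proof -
  have "\<iota> X \<in> left_invariant_fields atlas mul"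
    using iso bij_betw_imp_surj_on[of \<iota> UNIV "left_invariant_fields atlas mul"]
    by (auto simp: lie_algebra_iso_def)
  then show "smooth_fun atlas f \<Longrightarrow> smooth_fun atlas (\<iota> X f)"
    by (simp add: left_invariant_fields_def)
qed

lemma linear_field: "linear (\<lambda>X. \<iota> X f p)"
proof -
  have comb: "\<iota> (a *\<^sub>R X + b *\<^sub>R Y) f p = a * \<iota> X f p + b * \<iota> Y f p" for a b X Y
    using iso by (simp add: lie_algebra_iso_def)
  show ?thesis
    using comb[of 1 _ 1] comb[of _ _ 0] by (auto intro!: linearI)
qed

lemma field_bracket:
  "smooth_fun atlas f \<Longrightarrow> \<iota> (g66_bracket X Y) f p = \<iota> X (\<iota> Y f) p - \<iota> Y (\<iota> X f) p"
  using iso by (simp add: lie_algebra_iso_def)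

text \<open>By the one-parameter group law, time \<open>t\<close> from \<open>p\<close> is time 0
  from \<open>mul p (e (t *\<^sub>R X))\<close>, where \<open>exponential_map\<close> supplies the
  derivative.\<close>

lemma flow_derivative:
  assumes "smooth_fun atlas f"
  shows "((\<lambda>t. f (mul p (e (t *\<^sub>R X)))) has_real_derivative \<iota> X f (mul p (e (t *\<^sub>R X)))) (at t)"
proof -
  have "((\<lambda>s. f (mul (mul p (e (t *\<^sub>R X))) (e (s *\<^sub>R X)))) has_real_derivative
      \<iota> X f (mul p (e (t *\<^sub>R X)))) (at 0)"
    using exp assms by (simp add: exponential_map_def)
  then have "((\<lambda>s. f (mul p (e ((s + t) *\<^sub>R X)))) has_real_derivative
      \<iota> X f (mul p (e (t *\<^sub>R X)))) (at 0)"
    by (simp add: assoc add.commute flip: exp_add)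
  then show ?thesis
    using DERIV_shift[of "\<lambda>t. f (mul p (e (t *\<^sub>R X)))" _ 0 t] by simp
qed

lemma flow_derivative_0:
  "smooth_fun atlas f \<Longrightarrow>
     ((\<lambda>t. f (mul p (e (t *\<^sub>R X)))) has_real_derivative \<iota> X f p) (at 0)"
  using flow_derivative[of f p X 0] by (simp add: exp_zero right_neutral)

lemma smooth_const: "smooth_fun atlas (\<lambda>p. c)"
  using smooth_map_on_compose[of coords "\<lambda>v. c"] chart
  by (simp add: smooth_chart_def smooth_on_const)

lemma smooth_coord: "smooth_fun atlas (\<lambda>p. coords p $ k)"
  using smooth_map_on_compose[of coords "\<lambda>v. v $ k"] chart
  by (simp add: smooth_chart_def smooth_on_intros)

lemma field_const: "\<iota> X (\<lambda>p. c) p = 0"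
  by (rule DERIV_unique[OF flow_derivative_0[OF smooth_const]]) simp

lemma field_minus: "smooth_fun atlas f \<Longrightarrow> \<iota> X (\<lambda>p. - f p) p = - \<iota> X f p"
  using smooth_map_on_compose[of f uminus]
  by (intro DERIV_unique[OF flow_derivative_0 DERIV_minus[OF flow_derivative_0]])
    (simp_all add: smooth_on_intros)

text \<open>Subtracting the primitive of \<open>c + d * t\<close> leaves a function of
  \<open>t\<close> with zero derivative. Only the fifth coefficient of D_1 will need
  \<open>d = 1\<close>; all other transports have \<open>d = 0\<close>.\<close>

lemma along_flow:
  assumes "smooth_fun atlas f" "\<And>t. \<iota> X f (mul p (e (t *\<^sub>R X))) = c + d * t"
  shows "f (mul p (e (t *\<^sub>R X))) = f p + c * t + d * t\<^sup>2 / 2"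
proof -
  let ?h = "\<lambda>t. f (mul p (e (t *\<^sub>R X))) - c * t - d * t\<^sup>2 / 2"
  have "(?h has_real_derivative 0) (at t)" for t
    by (auto intro!: derivative_eq_intros flow_derivative[OF assms(1)] simp: assms(2))
  then have "?h t = ?h 0"
    using DERIV_isconst_all by blast
  then show ?thesis
    by (simp add: exp_zero right_neutral)
qed

section \<open>Transport of the coordinate derivatives along flows\<close>

definition translates :: "6 \<Rightarrow> 'g \<Rightarrow> bool" where
  "translates j p \<longleftrightarrow> (\<forall>t. coords (mul p (e (t *\<^sub>R bas j))) = coords p + t *\<^sub>R bas j)"

text \<open>When the coordinates after the j-th vanish, their factors in the product are
  \<open>one\<close>, and \<open>e (t *\<^sub>R bas j)\<close> merges with the j-th factor by
  \<open>exp_add\<close>.\<close>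

lemma translates_initial:
  "translates 6 p"
  "coords p $ 6 = 0 \<Longrightarrow> translates 5 p"
  "coords p $ 5 = 0 \<Longrightarrow> coords p $ 6 = 0 \<Longrightarrow> translates 4 p"
  "coords p $ 4 = 0 \<Longrightarrow> coords p $ 5 = 0 \<Longrightarrow> coords p $ 6 = 0 \<Longrightarrow> translates 3 p"
  "coords p $ 3 = 0 \<Longrightarrow> coords p $ 4 = 0 \<Longrightarrow> coords p $ 5 = 0 \<Longrightarrow> coords p $ 6 = 0 \<Longrightarrow>
     translates 2 p"
  "coords p $ 2 = 0 \<Longrightarrow> coords p $ 3 = 0 \<Longrightarrow> coords p $ 4 = 0 \<Longrightarrow> coords p $ 5 = 0 \<Longrightarrow>
     coords p $ 6 = 0 \<Longrightarrow> translates 1 p"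
proof -
  have p: "p = mul (e (coords p $ 1 *\<^sub>R bas 1)) (mul (e (coords p $ 2 *\<^sub>R bas 2))
      (mul (e (coords p $ 3 *\<^sub>R bas 3)) (mul (e (coords p $ 4 *\<^sub>R bas 4))
      (mul (e (coords p $ 5 *\<^sub>R bas 5)) (e (coords p $ 6 *\<^sub>R bas 6))))))"
    using coords_iff[of p "coords p"] by (simp add: assoc)
  have p_mul: "mul p x = mul (e (coords p $ 1 *\<^sub>R bas 1)) (mul (e (coords p $ 2 *\<^sub>R bas 2))
      (mul (e (coords p $ 3 *\<^sub>R bas 3)) (mul (e (coords p $ 4 *\<^sub>R bas 4))
      (mul (e (coords p $ 5 *\<^sub>R bas 5)) (mul (e (coords p $ 6 *\<^sub>R bas 6)) x)))))" for x
    using arg_cong[OF p, of "\<lambda>p. mul p x"] by (simp only: assoc)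
  show
    "translates 6 p"
    "coords p $ 6 = 0 \<Longrightarrow> translates 5 p"
    "coords p $ 5 = 0 \<Longrightarrow> coords p $ 6 = 0 \<Longrightarrow> translates 4 p"
    "coords p $ 4 = 0 \<Longrightarrow> coords p $ 5 = 0 \<Longrightarrow> coords p $ 6 = 0 \<Longrightarrow> translates 3 p"
    "coords p $ 3 = 0 \<Longrightarrow> coords p $ 4 = 0 \<Longrightarrow> coords p $ 5 = 0 \<Longrightarrow> coords p $ 6 = 0 \<Longrightarrow>
       translates 2 p"
    "coords p $ 2 = 0 \<Longrightarrow> coords p $ 3 = 0 \<Longrightarrow> coords p $ 4 = 0 \<Longrightarrow> coords p $ 5 = 0 \<Longrightarrow>
       coords p $ 6 = 0 \<Longrightarrow> translates 1 p"
    by (simp_all add: translates_def coords_iff p_mul bas_nth exp_zero exp_add assoc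
        group_left_neutral)
qed

lemma translates_field: "translates j p \<Longrightarrow> \<iota> (bas j) (\<lambda>p. coords p $ k) p = bas j $ k"
  by (rule DERIV_unique[OF flow_derivative_0[OF smooth_coord]])
    (auto simp: translates_def intro!: derivative_eq_intros)

text \<open>Converse of \<open>translates_field\<close>, from its conclusion at all points: constant
  derivatives along the flow integrate to a translation.\<close>

lemma field_translates:
  assumes "\<And>p k. \<iota> (bas j) (\<lambda>p. coords p $ k) p = bas j $ k"
  shows "translates j p"
  unfolding translates_def vec_eq_iff
  using along_flow[OF smooth_coord, where X = "bas j" and d = 0, OF trans[OF assms]]
  by (simp add: mult.commute)

text \<open>D_i v_k is constant, so D_j annihilates it and the commutator reduces to its first
  term.\<close>

lemma field_bracket_translates:
  assumes "\<And>p. translates i p"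
  shows "\<iota> (bas i) (\<iota> (bas j) (\<lambda>p. coords p $ k)) p
    = \<iota> (g66_bracket (bas i) (bas j)) (\<lambda>p. coords p $ k) p"
proof -
  have "\<iota> (bas i) (\<lambda>p. coords p $ k) = (\<lambda>p. bas i $ k)"
    using translates_field[OF assms] by auto
  then show ?thesis
    by (simp add: field_bracket[OF smooth_coord] field_const)
qed

text \<open>Where \<open>translates j p\<close> holds, this follows the flow of \<open>x_j\<close>
  to the hyperplane v_j = 0. Successive resets reach the points covered by
  \<open>translates_initial\<close>.\<close>

definition reset :: "6 \<Rightarrow> 'g \<Rightarrow> 'g" where
  "reset j p = mul p (e ((- (coords p $ j)) *\<^sub>R bas j))"

lemma coords_reset:
  "translates j p \<Longrightarrow> coords (reset j p) $ k = (if j = k then 0 else coords p $ k)"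
  unfolding translates_def reset_def
  by (drule spec[of _ "- (coords p $ j)"]) (simp add: bas_nth)

text \<open>By \<open>field_bracket_translates\<close>, D_j v_k changes at the constant rate
  \<open>c\<close> along the flow of \<open>x_i\<close>. The reset takes time
  \<open>- (coords p $ i)\<close>, hence the sign of the last term.\<close>

lemma field_reset:
  assumes "\<And>p. translates i p"
    and "\<And>p. \<iota> (g66_bracket (bas i) (bas j)) (\<lambda>p. coords p $ k) p = c"
  shows "\<iota> (bas j) (\<lambda>p. coords p $ k) p
    = \<iota> (bas j) (\<lambda>p. coords p $ k) (reset i p) + c * coords p $ i"
  using along_flow[OF smooth_field[OF smooth_coord],
      where X = "bas i" and c = c and d = 0 and t = "- (coords p $ i)" and p = p]
  by (simp add: reset_def field_bracket_translates[OF assms(1)] assms(2))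

text \<open>A vanishing bracket makes the rate zero; the excluded pairs are those with nonzero
  bracket.\<close>

lemma field_reset_commuting:
  assumes "\<And>p. translates i p"
    and "(i, j) \<notin> {(1, 2), (2, 1), (2, 3), (3, 2), (2, 4), (4, 2)}"
  shows "\<iota> (bas j) (\<lambda>p. coords p $ k) (reset i p) = \<iota> (bas j) (\<lambda>p. coords p $ k) p"
  using field_reset[OF assms(1), of j k 0 p] g66_bracket_bas_zero[OF assms(2)]
    linear_0[OF linear_field]
  by simp

section \<open>The fields of \<open>x_6\<close>, \<open>x_5\<close>, \<open>x_4\<close>,
  \<open>x_3\<close>, in this order\<close>

lemma translates_6: "translates 6 p"
  by (rule translates_initial)

lemma field_reset_6:
  "\<iota> (bas j) (\<lambda>p. coords p $ k) (reset 6 p) = \<iota> (bas j) (\<lambda>p. coords p $ k) p"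
  by (rule field_reset_commuting[OF translates_6]) simp

text \<open>\<open>translates_initial\<close> applies after the reset along \<open>x_6\<close>, and
  since \<open>x_6\<close> is central the coefficients at \<open>p\<close> are the same. Directions
  4 and 3 repeat this with more resets.\<close>

lemma translates_5: "translates 5 p"
proof (rule field_translates)
  fix p :: 'g and k :: 6
  have "translates 5 (reset 6 p)"
    by (rule translates_initial) (simp_all add: coords_reset translates_6)
  then show "\<iota> (bas 5) (\<lambda>p. coords p $ k) p = bas 5 $ k"
    using translates_field[of 5 "reset 6 p" k] by (simp add: field_reset_6)
qed

lemma field_reset_5:
  "\<iota> (bas j) (\<lambda>p. coords p $ k) (reset 5 p) = \<iota> (bas j) (\<lambda>p. coords p $ k) p"
  by (rule field_reset_commuting[OF translates_5]) simp

lemma translates_4: "translates 4 p"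
proof (rule field_translates)
  fix p :: 'g and k :: 6
  have "translates 4 (reset 5 (reset 6 p))"
    by (rule translates_initial) (simp_all add: coords_reset translates_5 translates_6)
  then show "\<iota> (bas 4) (\<lambda>p. coords p $ k) p = bas 4 $ k"
    using translates_field[of 4 "reset 5 (reset 6 p)" k] by (simp add: field_reset_5 field_reset_6)
qed

text \<open>\<open>x_2\<close> is the only basis vector that does not commute with
  \<open>x_4\<close>; the same is true for \<open>x_3\<close>.\<close>

lemma field_reset_4:
  "j \<noteq> 2 \<Longrightarrow>
    \<iota> (bas j) (\<lambda>p. coords p $ k) (reset 4 p) = \<iota> (bas j) (\<lambda>p. coords p $ k) p"
  by (rule field_reset_commuting[OF translates_4]) simp

lemma translates_3: "translates 3 p"
proof (rule field_translates)
  fix p :: 'g and k :: 6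
  have "translates 3 (reset 4 (reset 5 (reset 6 p)))"
    by (rule translates_initial) (simp_all add: coords_reset translates_4 translates_5 translates_6)
  then show "\<iota> (bas 3) (\<lambda>p. coords p $ k) p = bas 3 $ k"
    using translates_field[of 3 "reset 4 (reset 5 (reset 6 p))" k]
    by (simp add: field_reset_4 field_reset_5 field_reset_6)
qed

lemma field_reset_3:
  "j \<noteq> 2 \<Longrightarrow>
    \<iota> (bas j) (\<lambda>p. coords p $ k) (reset 3 p) = \<iota> (bas j) (\<lambda>p. coords p $ k) p"
  by (rule field_reset_commuting[OF translates_3]) simp

section \<open>The fields of \<open>x_2\<close> and \<open>x_1\<close>\<close>

lemma g66_bracket_bas_swap:
  "g66_bracket (bas 2) (bas 1) = - bas 4"
  "g66_bracket (bas 3) (bas 2) = - bas 6"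
  "g66_bracket (bas 4) (bas 2) = - bas 5"
  using g66_bracket_bas g66_bracket_antisym by metis+

text \<open>Resets along 6, 5, 4, 3 lead to a point where D_2 = d/dv_2. Those along the central
  \<open>x_6\<close> and \<open>x_5\<close> change nothing; those along \<open>x_4\<close> and
  \<open>x_3\<close> contribute [x_4, x_2] = -x_5 and [x_3, x_2] = -x_6, weighted by v_4 and
  v_3.\<close>

lemma field_2:
  "\<iota> (bas 2) (\<lambda>p. coords p $ k) p
    = bas 2 $ k - bas 5 $ k * coords p $ 4 - bas 6 $ k * coords p $ 3"
proof -
  let ?p5 = "reset 5 (reset 6 p)"
  let ?q = "reset 3 (reset 4 ?p5)"
  have "translates 2 ?q"
    by (rule translates_initial)
      (simp_all add: coords_reset translates_3 translates_4 translates_5 translates_6)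
  then have "\<iota> (bas 2) (\<lambda>p. coords p $ k) ?q = bas 2 $ k"
    by (rule translates_field)
  moreover have "\<iota> (g66_bracket (bas 4) (bas 2)) (\<lambda>p. coords p $ k) p = - bas 5 $ k"
    and "\<iota> (g66_bracket (bas 3) (bas 2)) (\<lambda>p. coords p $ k) p = - bas 6 $ k" for p
    by (simp_all add: g66_bracket_bas_swap linear_neg[OF linear_field]
        translates_field translates_5 translates_6)
  note field_reset[OF translates_4 this(1), of ?p5]
    field_reset[OF translates_3 this(2), of "reset 4 ?p5"]
  ultimately show ?thesis
    by (simp add: coords_reset translates_4 translates_5 translates_6 field_reset_5 field_reset_6)
qed

text \<open>D_2 is not d/dv_2 everywhere, so \<open>field_reset\<close> cannot be used with
  \<open>i = 2\<close>. Its flow is still a translation where v_3 = ... = v_6 = 0, and D_1 v_k is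
  integrated there, starting from v_2 = 0.\<close>

lemma field_1_by_integration:
  assumes "\<And>q. \<iota> (bas 2) (\<iota> (bas 1) (\<lambda>p. coords p $ k)) q = c + d * coords q $ 2"
  shows "\<iota> (bas 1) (\<lambda>p. coords p $ k) p
    = bas 1 $ k + c * coords p $ 2 + d * (coords p $ 2)\<^sup>2 / 2"
proof -
  let ?p3 = "reset 3 (reset 4 (reset 5 (reset 6 p)))"
  let ?q = "reset 2 ?p3"
  have c3: "coords ?p3 $ k = (if k \<in> {1, 2} then coords p $ k else 0)" for k
    using forall_6[of "\<lambda>k. coords ?p3 $ k = (if k \<in> {1, 2} then coords p $ k else 0)"]
    by (simp add: coords_reset translates_3 translates_4 translates_5 translates_6)
  have "translates 2 ?p3"
    by (rule translates_initial) (simp_all add: c3)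
  then have cq: "coords ?q $ k = (if k = 1 then coords p $ 1 else 0)" for k
    by (simp add: coords_reset c3)
  \<comment> \<open>Only v_1 can be nonzero at \<open>?q\<close>. \<open>translates 1\<close> gives
    the initial value, and \<open>translates 2\<close> gives v_2 = t along the flow, so the
    integrand is \<open>c + d * t\<close>.\<close>
  have "translates 1 ?q" "translates 2 ?q"
    by (rule translates_initial; simp add: cq)+
  then have "\<iota> (bas 1) (\<lambda>p. coords p $ k) ?q = bas 1 $ k"
    and t: "coords (mul ?q (e (t *\<^sub>R bas 2))) $ 2 = t" for t
    by (auto simp: translates_field translates_def cq bas_nth)
  moreover have "\<iota> (bas 1) (\<lambda>p. coords p $ k) (mul ?q (e (t *\<^sub>R bas 2)))
      = \<iota> (bas 1) (\<lambda>p. coords p $ k) ?q + c * t + d * t\<^sup>2 / 2" for t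
    by (rule along_flow[OF smooth_field[OF smooth_coord]]) (simp add: assms t)
  \<comment> \<open>Flowing for time v_2 undoes the reset along \<open>x_2\<close>.\<close>
  moreover have "mul ?q (e (coords p $ 2 *\<^sub>R bas 2)) = ?p3"
    by (simp add: reset_def[of 2] c3 assoc exp_minus)
  \<comment> \<open>\<open>x_3\<close>, ..., \<open>x_6\<close> all commute with
    \<open>x_1\<close>.\<close>
  moreover have "\<iota> (bas 1) (\<lambda>p. coords p $ k) ?p3 = \<iota> (bas 1) (\<lambda>p. coords p $ k) p"
    by (simp add: field_reset_3 field_reset_4 field_reset_5 field_reset_6)
  ultimately show ?thesis
    by metis
qed

text \<open>From [x_2, x_1] = -x_4. As D_2 v_k is affine in v_3 and v_4 by \<open>field_2\<close>,
  the right-hand side only requires D_1 of these two coordinates.\<close>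

lemma field_2_field_1:
  "\<iota> (bas 2) (\<iota> (bas 1) (\<lambda>p. coords p $ k)) q
    = \<iota> (bas 1) (\<iota> (bas 2) (\<lambda>p. coords p $ k)) q - bas 4 $ k"
  using field_bracket[OF smooth_coord, of "bas 2" "bas 1" k q]
  by (simp add: g66_bracket_bas_swap linear_neg[OF linear_field] translates_field translates_4)

lemma field_1:
  "\<iota> (bas 1) (\<lambda>p. coords p $ k) p
    = bas 1 $ k - bas 4 $ k * coords p $ 2 + bas 5 $ k * (coords p $ 2)\<^sup>2 / 2"
proof -
  have f2: "\<iota> (bas 2) (\<lambda>p. coords p $ k)
      = (\<lambda>p. bas 2 $ k - bas 5 $ k * coords p $ 4 - bas 6 $ k * coords p $ 3)" for k
    using field_2 by auto
  \<comment> \<open>For these \<open>k\<close>, D_2 v_k is constant and D_1 kills it. The results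
    D_1 v_3 = 0 and D_1 v_4 = -v_2 feed the two remaining coordinates.\<close>
  have *: "\<iota> (bas 1) (\<lambda>p. coords p $ k) p = bas 1 $ k - bas 4 $ k * coords p $ 2"
    if "k \<in> {1, 2, 3, 4}" for k p
    using field_1_by_integration[of k "- bas 4 $ k" 0] that
    by (auto simp: field_2_field_1 f2 bas_nth field_const)
  \<comment> \<open>D_2 v_5 = -v_4 gives D_2 D_1 v_5 = v_2, that is \<open>c = 0\<close> and
    \<open>d = 1\<close>.\<close>
  have "\<iota> (bas 1) (\<lambda>p. coords p $ 5) p = (coords p $ 2)\<^sup>2 / 2"
    using field_1_by_integration[of 5 0 1] *[of 4]
    by (simp add: field_2_field_1 f2 bas_nth field_minus[OF smooth_coord])
  \<comment> \<open>D_2 v_6 = -v_3 and D_1 v_3 = 0 give D_2 D_1 v_6 = 0.\<close>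
  moreover have "\<iota> (bas 1) (\<lambda>p. coords p $ 6) p = 0"
    using field_1_by_integration[of 6 0 0] *[of 3]
    by (simp add: field_2_field_1 f2 bas_nth field_minus[OF smooth_coord])
  ultimately have "\<forall>k. \<iota> (bas 1) (\<lambda>p. coords p $ k) p
    = bas 1 $ k - bas 4 $ k * coords p $ 2 + bas 5 $ k * (coords p $ 2)\<^sup>2 / 2"
    unfolding forall_6 by (simp add: * bas_nth)
  then show ?thesis ..
qed

lemma field_coords:
  "\<iota> X (\<lambda>p. coords p $ 1) p = X $ 1"
  "\<iota> X (\<lambda>p. coords p $ 2) p = X $ 2"
  "\<iota> X (\<lambda>p. coords p $ 3) p = X $ 3"
  "\<iota> X (\<lambda>p. coords p $ 4) p = X $ 4 - X $ 1 * coords p $ 2"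
  "\<iota> X (\<lambda>p. coords p $ 5) p = X $ 5 + X $ 1 * (coords p $ 2)\<^sup>2 / 2 - X $ 2 * coords p $ 4"
  "\<iota> X (\<lambda>p. coords p $ 6) p = X $ 6 - X $ 2 * coords p $ 3"
proof -
  have "X = (\<Sum>j\<in>UNIV. X $ j *\<^sub>R bas j)"
    by (simp add: vec_eq_iff bas_nth if_distrib cong: if_cong)
  then have "\<iota> X f p = (\<Sum>j\<in>UNIV. X $ j * \<iota> (bas j) f p)" for f
    using linear_sum[OF linear_field[where f = f and p = p], of "\<lambda>j. X $ j *\<^sub>R bas j" UNIV]
    by (simp add: linear_scale[OF linear_field])
  note * = this[unfolded UNIV_6]
  show
    "\<iota> X (\<lambda>p. coords p $ 1) p = X $ 1"
    "\<iota> X (\<lambda>p. coords p $ 2) p = X $ 2"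
    "\<iota> X (\<lambda>p. coords p $ 3) p = X $ 3"
    "\<iota> X (\<lambda>p. coords p $ 4) p = X $ 4 - X $ 1 * coords p $ 2"
    "\<iota> X (\<lambda>p. coords p $ 5) p = X $ 5 + X $ 1 * (coords p $ 2)\<^sup>2 / 2 - X $ 2 * coords p $ 4"
    "\<iota> X (\<lambda>p. coords p $ 6) p = X $ 6 - X $ 2 * coords p $ 3"
    by (simp_all add: * field_1 field_2 translates_field translates_3 translates_4 translates_5
        translates_6 bas_nth algebra_simps)
qed

section \<open>The Cauchy-Riemann equations\<close>

lemma left_derivative_eqI:
  "((\<lambda>t. f (mul p (e (t *\<^sub>R X)))) has_vector_derivative D) (at 0) \<Longrightarrow>
     left_derivative mul e X f p = D"
  unfolding left_derivative_def by (rule vector_derivative_at)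

text \<open>The differential of \<open>w1\<close> on the left invariant field of \<open>X\<close>.
  It takes no point, unlike \<open>dw2\<close> and \<open>dw3\<close>, because v_1 and v_2 have
  constant derivatives along these fields.\<close>

definition dw1 :: "real ^ 6 \<Rightarrow> complex" where
  "dw1 X = X $ 1 + \<i> * X $ 2"

definition dw2 :: "real ^ 6 \<Rightarrow> 'g \<Rightarrow> complex" where
  "dw2 X p = X $ 3 + \<i> * (X $ 4 - X $ 1 * coords p $ 2)"

definition dw3 :: "real ^ 6 \<Rightarrow> 'g \<Rightarrow> complex" where
  "dw3 X p = X $ 5 + X $ 1 * (coords p $ 2)\<^sup>2 / 2 - X $ 2 * coords p $ 4
     - \<i> * (X $ 6 - X $ 2 * coords p $ 3)"

lemma w_flow_derivative:
  "((\<lambda>t. w1 coords (mul p (e (t *\<^sub>R X)))) has_vector_derivative dw1 X) (at 0)"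
  "((\<lambda>t. w2 coords (mul p (e (t *\<^sub>R X)))) has_vector_derivative dw2 X p) (at 0)"
  "((\<lambda>t. w3 coords (mul p (e (t *\<^sub>R X)))) has_vector_derivative dw3 X p) (at 0)"
  unfolding w1_def w2_def w3_def dw1_def dw2_def dw3_def
  by (auto intro!: derivative_eq_intros flow_derivative_0[OF smooth_coord] simp: field_coords)

lemma left_derivative_phi1: "left_derivative mul e X (phi1 coords) p = dw1 X"
  unfolding phi1_def by (rule left_derivative_eqI w_flow_derivative)+

lemma left_derivative_phi2:
  "left_derivative mul e X (phi2 coords) p = dw2 X p
     + (dw1 X * cnj (w1 coords p) + w1 coords p * cnj (dw1 X)
        - cnj (w1 coords p) * cnj (dw1 X)) / 4"
  unfolding phi2_def power2_eq_square
  by (rule left_derivative_eqI)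
    (auto intro!: derivative_eq_intros w_flow_derivative has_vector_derivative_cnj
      simp: exp_zero field_simps)

lemma left_derivative_phi3:
  "left_derivative mul e X (phi3 coords) p = dw3 X p
     + (- 3 * (cnj (w1 coords p))\<^sup>2 * cnj (dw1 X)
        + 3 * cnj (dw1 X) * (w1 coords p)\<^sup>2 + 6 * cnj (w1 coords p) * w1 coords p * dw1 X
        + 24 * cnj (dw1 X) * w2 coords p + 24 * cnj (w1 coords p) * dw2 X p) / 48"
  unfolding phi3_def power2_eq_square power3_eq_cube
  by (rule left_derivative_eqI)
    (auto intro!: derivative_eq_intros w_flow_derivative has_vector_derivative_cnj
      simp: exp_zero field_simps)

lemma smooth_phi:
  "smooth_map_on atlas std_atlas UNIV (phi1 coords)"
  "smooth_map_on atlas std_atlas UNIV (phi2 coords)"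
  "smooth_map_on atlas std_atlas UNIV (phi3 coords)"
proof -
  have c: "smooth_map_on atlas std_atlas UNIV coords"
    using chart by (simp add: smooth_chart_def)
  show
    "smooth_map_on atlas std_atlas UNIV (phi1 coords)"
    "smooth_map_on atlas std_atlas UNIV (phi2 coords)"
    "smooth_map_on atlas std_atlas UNIV (phi3 coords)"
    using smooth_on_phi[THEN smooth_map_on_compose[OF c]] by (simp_all only: phi_id)
qed

text \<open>Measures the failure of holomorphy: none for \<open>w1\<close>, and multiples of
  \<open>cnj (dw1 X)\<close> for \<open>w2\<close> and \<open>w3\<close>, which the correction terms
  in \<open>phi2\<close> and \<open>phi3\<close> have to cancel.\<close>

lemma dw_J:
  "dw1 X + \<i> * dw1 (g66_J X) = 0"
  "cnj (dw1 X) + \<i> * cnj (dw1 (g66_J X)) = 2 * cnj (dw1 X)"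
  "dw2 X p + \<i> * dw2 (g66_J X) p = - \<i> * coords p $ 2 * cnj (dw1 X)"
  "dw3 X p + \<i> * dw3 (g66_J X) p = cnj (dw1 X) * ((coords p $ 2)\<^sup>2 / 2 - w2 coords p)"
  by (simp_all add: dw1_def dw2_def dw3_def w2_def g66_J_def bas_nth complex_eq_iff
      algebra_simps power2_eq_square)

lemma cauchy_riemann_phi:
  "left_derivative mul e X (phi1 coords) p
    + \<i> * left_derivative mul e (g66_J X) (phi1 coords) p = 0"
  "left_derivative mul e X (phi2 coords) p
    + \<i> * left_derivative mul e (g66_J X) (phi2 coords) p = 0"
  "left_derivative mul e X (phi3 coords) p
    + \<i> * left_derivative mul e (g66_J X) (phi3 coords) p = 0"
proof -
  \<comment> \<open>Converts differences of \<open>w1\<close> and its conjugate into v_2, the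
    variable in which \<open>dw_J\<close> expresses the defects.\<close>
  have w1: "w1 coords p = cnj (w1 coords p) + 2 * \<i> * coords p $ 2"
    by (simp add: w1_def complex_eq_iff)
  show "left_derivative mul e X (phi1 coords) p
      + \<i> * left_derivative mul e (g66_J X) (phi1 coords) p = 0"
    by (simp add: left_derivative_phi1 dw_J)
  \<comment> \<open>Grouped by differentials, every term has the shape treated by
    \<open>dw_J\<close>; what remains is -i v_2 and +i v_2 times \<open>cnj (dw1 X)\<close>.\<close>
  have "left_derivative mul e X (phi2 coords) p
      + \<i> * left_derivative mul e (g66_J X) (phi2 coords) p
    = (dw2 X p + \<i> * dw2 (g66_J X) p)
      + ((dw1 X + \<i> * dw1 (g66_J X)) * cnj (w1 coords p)
        + (w1 coords p - cnj (w1 coords p)) * (cnj (dw1 X) + \<i> * cnj (dw1 (g66_J X)))) / 4"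
    unfolding left_derivative_phi2 by (simp add: field_simps)
  then show "left_derivative mul e X (phi2 coords) p
      + \<i> * left_derivative mul e (g66_J X) (phi2 coords) p = 0"
    unfolding dw_J by (subst (asm) w1) simp
  have "left_derivative mul e X (phi3 coords) p
      + \<i> * left_derivative mul e (g66_J X) (phi3 coords) p
    = (dw3 X p + \<i> * dw3 (g66_J X) p)
      + (3 * ((w1 coords p)\<^sup>2 - (cnj (w1 coords p))\<^sup>2 + 8 * w2 coords p)
          * (cnj (dw1 X) + \<i> * cnj (dw1 (g66_J X)))
        + 6 * cnj (w1 coords p) * w1 coords p * (dw1 X + \<i> * dw1 (g66_J X))
        + 24 * cnj (w1 coords p) * (dw2 X p + \<i> * dw2 (g66_J X) p)) / 48"
    unfolding left_derivative_phi3 by (simp add: field_simps)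
  \<comment> \<open>The first term cancels the contribution of \<open>dw2\<close>, the second the
    v_2^2/2 from \<open>dw3\<close>; the summand with \<open>8 * w2 coords p\<close> above cancels
    the remaining part of \<open>dw3\<close>.\<close>
  moreover have "(w1 coords p)\<^sup>2 - (cnj (w1 coords p))\<^sup>2
      = 4 * \<i> * coords p $ 2 * cnj (w1 coords p) - 4 * (coords p $ 2)\<^sup>2"
    by (subst w1) (simp add: power2_eq_square algebra_simps)
  ultimately show "left_derivative mul e X (phi3 coords) p
      + \<i> * left_derivative mul e (g66_J X) (phi3 coords) p = 0"
    unfolding dw_J by (simp add: field_simps)
qed

lemma J_holomorphic_phi:
  "J_holomorphic_on atlas mul e g66_J UNIV (phi1 coords)"
  "J_holomorphic_on atlas mul e g66_J UNIV (phi2 coords)"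
  "J_holomorphic_on atlas mul e g66_J UNIV (phi3 coords)"
  using smooth_phi cauchy_riemann_phi by (simp_all add: J_holomorphic_on_def)

section \<open>The global holomorphic chart\<close>

lemma surj_coords: "surj coords"
  using coords_iff by (metis surj_def)

lemma holomorphic_chart_phi:
  "(UNIV, \<lambda>p. phi_map (coords p)) \<in> holomorphic_charts atlas mul e g66_J"
proof -
  have "smooth_chart atlas UNIV (\<lambda>p. phi_map (coords p))"
    by (rule smooth_chart_compose[OF chart surj_coords smooth_on_phi_map smooth_on_phi_inv
          phi_inv_phi_map phi_map_phi_inv])
  moreover have "J_holomorphic_on atlas mul e g66_J UNIV (\<lambda>p. phi_map (coords p) $ k)" for k
    using J_holomorphic_phi exhaust_3[of k] by (auto simp: phi_map_def phi_id)
  ultimately show ?thesis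
    by (simp add: holomorphic_charts_def)
qed

end

theorem mainTheorem14:
  fixes atlas :: "('g::{t2_space, second_countable_topology}, real ^ 6) chart set"
    and mul :: "'g \<Rightarrow> 'g \<Rightarrow> 'g" and one :: 'g and invert :: "'g \<Rightarrow> 'g"
    and \<iota> :: "real ^ 6 \<Rightarrow> ('g \<Rightarrow> real) \<Rightarrow> 'g \<Rightarrow> real"
    and e :: "real ^ 6 \<Rightarrow> 'g"
    and coords :: "'g \<Rightarrow> real ^ 6"
    and F :: "'g \<Rightarrow> complex ^ 3"
  assumes "lie_group atlas mul one invert"
    and "connected (UNIV :: 'g set)"
    and "simply_connected (UNIV :: 'g set)"
    and "lie_algebra_iso atlas mul g66_bracket \<iota>"
    and "exponential_map atlas mul \<iota> e"
    and "smooth_chart atlas UNIV coords"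
    and "\<And>p v. coords p = v \<longleftrightarrow>
           p = mul (mul (mul (mul (mul
                 (e (v $ 1 *\<^sub>R bas 1)) (e (v $ 2 *\<^sub>R bas 2))) (e (v $ 3 *\<^sub>R bas 3)))
                 (e (v $ 4 *\<^sub>R bas 4))) (e (v $ 5 *\<^sub>R bas 5))) (e (v $ 6 *\<^sub>R bas 6))"
    and "\<And>p. F p = vector [phi1 coords p, phi2 coords p, phi3 coords p]"
  shows "J_holomorphic_on atlas mul e g66_J UNIV (phi1 coords) \<and>
         J_holomorphic_on atlas mul e g66_J UNIV (phi2 coords) \<and>
         J_holomorphic_on atlas mul e g66_J UNIV (phi3 coords) \<and>
         (UNIV, F) \<in> holomorphic_charts atlas mul e g66_J \<and>
         range F = UNIV"
proof -
  interpret g66_group atlas mul one invert \<iota> e coords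
    using assms(1,4-7) by (intro g66_group.intro g66_group_axioms.intro)
  have F: "F = (\<lambda>p. phi_map (coords p))"
    using assms(8) by (simp add: phi_map_def phi_id fun_eq_iff)
  \<comment> \<open>A preimage of \<open>z\<close> is a point with coordinates
    \<open>phi_inv z\<close>.\<close>
  have "range F = UNIV"
    unfolding F by (metis phi_map_phi_inv surj_coords surj_def)
  then show ?thesis
    using J_holomorphic_phi holomorphic_chart_phi by (simp add: F)
qed

end
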